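(* Let $n\geq 2$ and let $x$ be a $2$-element of the symmetric group $S_n$. Then $x$ lies in a unique Sylow $2$-subgroup of $S_n$ if and only if $x$ has at most two fixed points and all cycles of $x$ (in its disjoint cycle decomposition) of length bigger than one have pairwise different lengths. *)

theory Defs
  imports "HOL-Algebra.Sym_Groups" "HOL-Algebra.Multiplicative_Group" "HOL-Computational_Algebra.Primes" "HOL-Combinatorics.Orbits"
begin

definition sylow_subgroup :: "('a, 'b) monoid_scheme \<Rightarrow> nat \<Rightarrow> 'a set \<Rightarrow> bool" where
  "sylow_subgroup G p P \<longleftrightarrow> subgroup P G \<and> card P = p ^ multiplicity p (order G)"

definition p_element :: "('a, 'b) monoid_scheme \<Rightarrow> nat \<Rightarrow> 'a \<Rightarrow> bool" where
  "p_element G p x \<longleftrightarrow> x \<in> carrier G \<and> (\<exists>k. group.ord G x = p ^ k)"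

definition fixed_points :: "nat \<Rightarrow> (nat \<Rightarrow> nat) \<Rightarrow> nat set" where
  "fixed_points n x = {i \<in> {1..n}. x i = i}"

definition nontrivial_cycle_lengths_distinct :: "nat \<Rightarrow> (nat \<Rightarrow> nat) \<Rightarrow> bool" where
  "nontrivial_cycle_lengths_distinct n x \<longleftrightarrow>
     (\<forall>i\<in>{1..n}. \<forall>j\<in>{1..n}. x i \<noteq> i \<longrightarrow> x j \<noteq> j \<longrightarrow>
        card (Orbits.orbit x i) = card (Orbits.orbit x j) \<longrightarrow> Orbits.orbit x i = Orbits.orbit x j)"

end

theory Submission
  imports Defs "HOL-Algebra.Group_Action" "HOL-Algebra.Sylow"
begin

text \<open>
  Call a permutation of a finite set \<open>A\<close> a pairing if it is an involution with at most one fixed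
  point. The number of pairings is odd, so every 2-group \<open>Q\<close> of permutations of \<open>A\<close>, acting by
  conjugation, centralizes some pairing \<open>s\<close>. If \<open>x \<in> Q\<close> satisfies the cycle condition, then \<open>s\<close>
  commutes with \<open>x\<close>, and this determines it: \<open>s\<close> is the half rotation on each nontrivial cycle and
  exchanges the two fixed points if there are two. Hence all 2-groups containing \<open>x\<close> act on the
  set of pairs \<open>{i, s i}\<close>, where the image of \<open>x\<close> satisfies the cycle condition again; as the kernel
  of this action is a 2-group, induction gives a greatest 2-group containing \<open>x\<close>.

  Conversely, let \<open>P\<close> be the only Sylow 2-subgroup containing \<open>x\<close>, so that it contains every 2-group
  containing \<open>x\<close>. If \<open>a\<close> and \<open>b\<close> lie in different orbits of equal length, let \<open>s\<close> exchange
  \<open>x\<^sup>k a\<close> and \<open>x\<^sup>k b\<close>. The permutations commuting with \<open>s\<close> that act on the pairs \<open>{i, s i}\<close> like a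
  power of \<open>x\<close> form a 2-group, which contains \<open>x\<close> and the transposition \<open>(a b)\<close>; so \<open>(a b) \<in> P\<close>.
  If the cycle condition fails, two such transpositions have one point in common, and their product
  is an element of order 3 in \<open>P\<close>.
\<close>

section \<open>Actions of \<open>p\<close>-groups and Sylow subgroups\<close>

text \<open>By orbit-stabilizer the length of an orbit divides \<open>p ^ k\<close>, so every orbit
  other than a fixed point has length divisible by \<open>p\<close>. The action is a plain function
  \<open>act\<close> rather than a homomorphism into \<open>BijGroup\<close>, so that conjugation
  and translation of cosets fit directly.\<close>

lemma p_group_card_cong_fixed_points:
  assumes "group G" "prime p" "order G = p ^ k" "finite S"
    and closed: "\<And>g s. g \<in> carrier G \<Longrightarrow> s \<in> S \<Longrightarrow> act g s \<in> S"
    and one: "\<And>s. s \<in> S \<Longrightarrow> act \<one>\<^bsub>G\<^esub> s = s"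
    and mult: "\<And>g h s. g \<in> carrier G \<Longrightarrow> h \<in> carrier G \<Longrightarrow> s \<in> S \<Longrightarrow>
                 act (g \<otimes>\<^bsub>G\<^esub> h) s = act g (act h s)"
  shows "card S mod p = card {s \<in> S. \<forall>g\<in>carrier G. act g s = s} mod p"
proof -
  interpret G: group G by fact
  \<comment> \<open>Elements of \<open>BijGroup S\<close> are extensional, hence the
    restriction.\<close>
  define \<phi> where "\<phi> = (\<lambda>g. restrict (act g) S)"
  define F where "F = {s \<in> S. \<forall>g\<in>carrier G. act g s = s}"
  have inv_act: "act (inv\<^bsub>G\<^esub> g) (act g s) = s" "act g (act (inv\<^bsub>G\<^esub> g) s) = s"
    if "g \<in> carrier G" "s \<in> S" for g s
    using that mult[of "inv\<^bsub>G\<^esub> g" g s] mult[of g "inv\<^bsub>G\<^esub> g" s] one by simp_all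
  have "bij_betw (act g) S S" if "g \<in> carrier G" for g
    by (rule bij_betw_byWitness[where f' = "act (inv\<^bsub>G\<^esub> g)"]) (use that inv_act closed in auto)
  then have Bij: "\<phi> g \<in> Bij S" if "g \<in> carrier G" for g
    using that by (auto simp: \<phi>_def Bij_def)
  have "\<phi> \<in> hom G (BijGroup S)"
    by (rule homI) (auto simp: BijGroup_def Bij, auto simp: \<phi>_def compose_def mult closed)
  then interpret group_action G S \<phi>
    by (auto simp: group_action_def group_hom_def group_hom_axioms_def group_BijGroup)
  have orbit_eq: "Group_Action.orbit G \<phi> s = {act g s | g. g \<in> carrier G}" if "s \<in> S" for s
    using that by (auto simp: Group_Action.orbit_def \<phi>_def)
  have orbit_sub: "Group_Action.orbit G \<phi> s \<subseteq> S - F" if s: "s \<in> S - F" for s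
  proof
    fix t assume "t \<in> Group_Action.orbit G \<phi> s"
    then obtain g where g: "g \<in> carrier G" "t = act g s" using s orbit_eq by auto
    have "t \<notin> F"
    proof
      assume "t \<in> F"
      have "s = t"
        using \<open>t \<in> F\<close> g inv_act(1)[of g s] s by (simp add: F_def)
      with \<open>t \<in> F\<close> s show False by simp
    qed
    then show "t \<in> S - F" using g s closed by simp
  qed
  have fin: "finite (S - F)" using assms by simp
  define C where "C = Group_Action.orbit G \<phi> ` (S - F)"
  have un: "\<Union>C = S - F"
    using orbit_sub orbit_refl unfolding C_def by fast
  have "p dvd card (\<Union>C)"
  proof (rule dvd_partition)
    show "finite (\<Union>C)" using un fin by simp
    show "\<forall>c\<in>C. p dvd card c"
    proof
      fix c assume "c \<in> C"
      then obtain s where s: "s \<in> S - F" "c = Group_Action.orbit G \<phi> s" by (auto simp: C_def)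
      then have "card c * card (stabilizer G \<phi> s) = p ^ k"
        using orbit_stabilizer_theorem[of s] assms(3) by simp
      then have "card c dvd p ^ k" by (metis dvd_triv_left)
      then obtain j where j: "card c = p ^ j" using \<open>prime p\<close> divides_primepow_nat by blast
      have "s \<in> c" using s orbit_refl by simp
      have "j \<noteq> 0"
      proof
        assume "j = 0"
        then have "c = {s}" using j \<open>s \<in> c\<close> by (auto simp: card_1_singleton_iff)
        then have "\<forall>g\<in>carrier G. act g s = s" using s orbit_eq[of s] by blast
        then show False using s by (simp add: F_def)
      qed
      then show "p dvd card c" using j by simp
    qed
    show "\<forall>c1\<in>C. \<forall>c2\<in>C. c1 \<noteq> c2 \<longrightarrow> c1 \<inter> c2 = {}"
      using disjoint_union unfolding C_def orbits_def by blast
  qed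
  then have "p dvd card S - card F"
    using un fin assms(4) by (simp add: card_Diff_subset F_def finite_subset)
  moreover have "card F \<le> card S" using assms(4) by (auto simp: F_def intro: card_mono)
  ultimately show ?thesis
    unfolding F_def[symmetric] by (simp add: mod_eq_dvd_iff_nat)
qed

text \<open>Cauchy's argument: a further prime divisor \<open>q\<close> of the order would yield a
  nontrivial element whose order divides both \<open>q\<close> and a power of
  \<open>p\<close>.\<close>

lemma (in group) order_prime_power_if_elements:
  assumes "finite (carrier G)" "prime p"
    and "\<And>g. g \<in> carrier G \<Longrightarrow> \<exists>k. g [^] (p ^ k :: nat) = \<one>"
  shows "\<exists>k. order G = p ^ k"
proof -
  have "order G \<noteq> 0" using assms(1) by (simp add: order_gt_0_iff_finite)
  then obtain m where m: "order G = p ^ multiplicity p (order G) * m" "\<not> p dvd m"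
    using multiplicity_decompose' [of "order G" p] assms(2)
    by (metis not_prime_unit)
  have "m = 1"
  proof (rule ccontr)
    assume "m \<noteq> 1"
    then obtain q where q: "prime q" "q dvd m" using prime_factor_nat by blast
    then have "q \<noteq> p" using m by auto
    \<comment> \<open>Sylow's theorem with exponent 1 serves as Cauchy's theorem.\<close>
    obtain l where "order G = q ^ 1 * l" using q m(1) by (metis dvd_def dvd_mult power_one_right)
    then obtain H where H: "subgroup H G" "card H = q"
      using sylow_thm[OF q(1) is_group _ assms(1)] by (metis power_one_right)
    have "card H \<noteq> 1" using H q by auto
    then have "H \<noteq> {\<one>}" by auto
    then obtain h where h: "h \<in> H" "h \<noteq> \<one>" using subgroup.one_closed[OF H(1)] by blast
    have hG: "h \<in> carrier G" using h H subgroup.subset by blast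
    interpret K: group "G\<lparr>carrier := H\<rparr>" using H subgroup_imp_group by blast
    have "h [^]\<^bsub>G\<lparr>carrier := H\<rparr>\<^esub> order (G\<lparr>carrier := H\<rparr>) = \<one>"
      using K.pow_order_eq_1 h by simp
    then have "h [^] q = \<one>" using H by (simp add: order_def nat_pow_consistent[symmetric])
    then have "ord h dvd q" using hG by (simp add: pow_eq_id)
    moreover obtain k where "h [^] (p ^ k) = \<one>" using assms(3) hG by blast
    then have "ord h dvd p ^ k" using hG by (simp add: pow_eq_id)
    moreover have "coprime q (p ^ k)" using q \<open>q \<noteq> p\<close> assms(2) by (simp add: primes_coprime)
    ultimately have "ord h = 1" by (metis coprime_common_divisor nat_dvd_1_iff_1)
    then show False using h hG ord_eq_1 by blast
  qed
  then show ?thesis using m by auto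
qed

text \<open>\<open>H\<close> acts on the right cosets of a Sylow subgroup \<open>P\<close>. Their
  number is prime to \<open>p\<close>, so \<open>H\<close> fixes some coset \<open>P #> g\<close>
  and therefore lies in the conjugate of \<open>P\<close> by \<open>g\<close>.\<close>

lemma (in group) p_subgroup_in_sylow_subgroup:
  assumes "finite (carrier G)" "prime p" "subgroup H G" "card H = p ^ k"
  obtains Q where "sylow_subgroup G p Q" "H \<subseteq> Q"
proof -
  have "order G \<noteq> 0" using assms(1) by (simp add: order_gt_0_iff_finite)
  then obtain m where m: "order G = p ^ multiplicity p (order G) * m" "\<not> p dvd m"
    using multiplicity_decompose' [of "order G" p] assms(2)
    by (metis not_prime_unit)
  obtain P where P: "subgroup P G" "card P = p ^ multiplicity p (order G)"
    using sylow_thm[OF assms(2) is_group m(1) assms(1)] by blast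
  interpret H: subgroup H G by fact
  interpret P: subgroup P G by fact
  interpret K: group "G\<lparr>carrier := H\<rparr>" using assms(3) subgroup_imp_group by blast
  have "card (rcosets P) * card P = order G"
    using lagrange P by blast
  then have card: "card (rcosets P) = m"
    using m(1) P(2) assms(2) by (metis mult.commute mult_left_cancel not_prime_0 power_not_zero)
  \<comment> \<open>The inverse turns right multiplication of cosets into a left action.\<close>
  define F where "F = {C \<in> rcosets P. \<forall>h\<in>carrier (G\<lparr>carrier := H\<rparr>). C #> inv h = C}"
  have "card (rcosets P) mod p = card F mod p"
    unfolding F_def
  proof (rule p_group_card_cong_fixed_points)
    show "group (G\<lparr>carrier := H\<rparr>)" ..
    show "order (G\<lparr>carrier := H\<rparr>) = p ^ k" using assms(4) by (simp add: order_def)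
    show "finite (rcosets P)" using assms(1) by (simp add: RCOSETS_def)
    fix C assume "C \<in> rcosets P"
    then obtain g where g: "g \<in> carrier G" "C = P #> g" by (auto simp: RCOSETS_def)
    show "C #> inv \<one>\<^bsub>G\<lparr>carrier := H\<rparr>\<^esub> = C"
      using g by (simp add: coset_mult_assoc P.subset)
    fix h assume h: "h \<in> carrier (G\<lparr>carrier := H\<rparr>)"
    then have hG: "h \<in> carrier G" by simp
    show "C #> inv h \<in> rcosets P"
      using g hG by (auto simp: coset_mult_assoc P.subset RCOSETS_def)
    fix h' assume "h' \<in> carrier (G\<lparr>carrier := H\<rparr>)"
    then have "h' \<in> carrier G" by simp
    then show "C #> inv (h \<otimes>\<^bsub>G\<lparr>carrier := H\<rparr>\<^esub> h') = C #> inv h' #> inv h"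
      using g hG by (simp add: coset_mult_assoc P.subset inv_mult_group m_assoc)
  qed (use assms in auto)
  then have "\<not> p dvd card F" using card m by (metis dvd_eq_mod_eq_0)
  then have "F \<noteq> {}" by auto
  then obtain g where g: "g \<in> carrier G" "\<And>h. h \<in> H \<Longrightarrow> P #> g #> inv h = P #> g"
    by (auto simp: F_def RCOSETS_def)
  define Q where "Q = inv g <# P #> g"
  have Q: "Q = (\<lambda>q. inv g \<otimes> q \<otimes> g) ` P" by (auto simp: Q_def l_coset_def r_coset_def)
  have "inj_on (\<lambda>q. inv g \<otimes> q \<otimes> g) P"
    using g by (intro inj_onI) simp
  then have "card Q = card P" using Q by (simp add: card_image)
  moreover have "subgroup Q G" unfolding Q_def using g P subgroup_conjugation_is_surj1 by blast
  moreover have "H \<subseteq> Q"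
  proof
    fix h assume h: "h \<in> H"
    then have hG: "h \<in> carrier G" by simp
    have "P #> g #> h = P #> g" using g(2)[of "inv h"] h by simp
    then have "g \<otimes> h \<in> P #> g"
      using g hG rcos_self[OF _ P(1), of "g \<otimes> h"] by (simp add: coset_mult_assoc P.subset)
    then obtain q where "q \<in> P" "g \<otimes> h = q \<otimes> g" by (auto simp: r_coset_def)
    then have "h = inv g \<otimes> q \<otimes> g" using g hG
      by (metis P.mem_carrier inv_closed inv_solve_left m_assoc m_closed)
    then show "h \<in> Q" using Q \<open>q \<in> P\<close> by blast
  qed
  ultimately show thesis using that P by (auto simp: sylow_subgroup_def)
qed

section \<open>Orbits of a permutation\<close>

lemma card_orbit_eq_least_power:
  assumes "permutation f"
  shows "card (Orbits.orbit f a) = least_power f a"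
proof -
  have "(f ^^ least_power f a) a = a" "0 < least_power f a"
    using least_power_of_permutation[OF assms] by auto
  then have "Orbits.orbit f a = set (support f a)"
    by (auto simp: orbit_altdef_bounded)
  moreover have "distinct (support f a)"
    by (rule cycle_of_permutation[OF assms])
  ultimately show ?thesis using distinct_card[of "support f a"] by simp
qed

lemma funpow_fix_iff_card_orbit_dvd:
  assumes "permutation f"
  shows "(f ^^ k) a = a \<longleftrightarrow> card (Orbits.orbit f a) dvd k"
  using least_power_dvd[OF assms] by (simp add: card_orbit_eq_least_power[OF assms])

lemma funpow_eq_iff_mod_card_orbit:
  assumes "permutation f"
  shows "(f ^^ i) a = (f ^^ j) a \<longleftrightarrow> i mod card (Orbits.orbit f a) = j mod card (Orbits.orbit f a)"
proof -
  have *: "(f ^^ i) a = (f ^^ j) a \<longleftrightarrow> i mod card (Orbits.orbit f a) = j mod card (Orbits.orbit f a)"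
    if "i \<le> j" for i j
  proof -
    have "inj (f ^^ i)" using assms permutation_bijective bij_is_inj inj_fn by metis
    have "(f ^^ j) a = (f ^^ i) ((f ^^ (j - i)) a)"
      using that by (metis add_diff_inverse_nat comp_apply funpow_add not_less)
    then have "(f ^^ i) a = (f ^^ j) a \<longleftrightarrow> (f ^^ (j - i)) a = a"
      using \<open>inj (f ^^ i)\<close> by (metis injD)
    then show ?thesis
      using assms that by (metis funpow_fix_iff_card_orbit_dvd mod_eq_dvd_iff_nat)
  qed
  show ?thesis using *[of i j] *[of j i] by (metis nat_le_linear)
qed

lemma mem_orbit_iff_funpow:
  assumes "permutation f"
  shows "y \<in> Orbits.orbit f a \<longleftrightarrow> (\<exists>k. y = (f ^^ k) a)"
  using orbit_altdef_permutation[OF assms] by auto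

lemma orbit_eq_iff_mem:
  assumes "permutation f"
  shows "Orbits.orbit f a = Orbits.orbit f b \<longleftrightarrow> b \<in> Orbits.orbit f a"
proof
  assume "Orbits.orbit f a = Orbits.orbit f b"
  then show "b \<in> Orbits.orbit f a" using permutation_self_in_orbit[OF assms, of b] by blast
next
  assume "b \<in> Orbits.orbit f a"
  then show "Orbits.orbit f a = Orbits.orbit f b"
    by (rule orbit_cyclic_eq3[OF cyclic_on_orbit'[OF assms], symmetric])
qed

lemma funpow_commute:
  assumes "\<And>i. f (s i) = s (f i)"
  shows "(f ^^ k) (s i) = s ((f ^^ k) i)"
  by (induction k) (simp_all add: assms)

lemma image_orbit_commute:
  assumes "permutation f" "\<And>i. f (s i) = s (f i)"
  shows "s ` Orbits.orbit f i = Orbits.orbit f (s i)"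
  by (rule orbit_inverse[where f = s and g = f and g' = f]) (simp_all add: assms permutation_self_in_orbit)

section \<open>2-groups of permutations\<close>

text \<open>Closure under inverses is omitted: it follows from the finite order of the elements.\<close>

definition two_perm_group :: "'a set \<Rightarrow> ('a \<Rightarrow> 'a) set \<Rightarrow> bool" where
  "two_perm_group A H \<longleftrightarrow>
     (\<forall>h\<in>H. h permutes A) \<and> id \<in> H \<and> (\<forall>g\<in>H. \<forall>h\<in>H. g \<circ> h \<in> H) \<and> (\<forall>h\<in>H. \<exists>k. h ^^ (2 ^ k) = id)"

lemma two_perm_groupD:
  assumes "two_perm_group A H"
  shows "h \<in> H \<Longrightarrow> h permutes A" "id \<in> H" "g \<in> H \<Longrightarrow> h \<in> H \<Longrightarrow> g \<circ> h \<in> H"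
    "h \<in> H \<Longrightarrow> \<exists>k. h ^^ (2 ^ k) = id"
  using assms by (auto simp: two_perm_group_def)

lemma two_perm_group_funpow:
  assumes "two_perm_group A H" "h \<in> H"
  shows "h ^^ k \<in> H"
  by (induction k) (simp_all only: funpow.simps two_perm_groupD[OF assms(1)] assms(2))

lemma two_perm_group_inv:
  assumes "two_perm_group A H" "h \<in> H"
  shows "inv' h \<in> H"
proof -
  obtain k where k: "h ^^ (2 ^ k) = id" using two_perm_groupD[OF assms(1)] assms(2) by blast
  have "h ^^ (2 ^ k) = h \<circ> h ^^ (2 ^ k - 1)" "h ^^ (2 ^ k) = h ^^ (2 ^ k - 1) \<circ> h"
    by (metis Suc_pred' funpow.simps(2) zero_less_numeral zero_less_power,
        metis Suc_pred' funpow_Suc_right zero_less_numeral zero_less_power)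
  then have "inv' h = h ^^ (2 ^ k - 1)"
    using k by (metis inv_unique_comp)
  then show ?thesis using assms two_perm_group_funpow by metis
qed

lemma nat_pow_eq_funpow:
  assumes "mult G = (\<circ>)" "one G = id"
  shows "h [^]\<^bsub>G\<^esub> (k::nat) = h ^^ k"
  by (induction k) (simp_all add: assms funpow_Suc_right nat_pow_def del: funpow.simps(2))

text \<open>Makes the order and counting results for abstract groups available for sets of
  permutations.\<close>

lemma two_perm_group_group:
  assumes "two_perm_group A H"
  shows "group \<lparr>carrier = H, mult = (\<circ>), one = id\<rparr>"
proof (rule groupI)
  fix h assume "h \<in> carrier \<lparr>carrier = H, mult = (\<circ>), one = id\<rparr>"
  then have "inv' h \<in> H" "inv' h \<circ> h = id"
    using two_perm_group_inv[OF assms] two_perm_groupD(1)[OF assms] permutes_inv_o(2) by auto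
  then show "\<exists>g\<in>carrier \<lparr>carrier = H, mult = (\<circ>), one = id\<rparr>.
      g \<otimes>\<^bsub>\<lparr>carrier = H, mult = (\<circ>), one = id\<rparr>\<^esub> h = \<one>\<^bsub>\<lparr>carrier = H, mult = (\<circ>), one = id\<rparr>\<^esub>"
    by auto
qed (use two_perm_groupD[OF assms] in \<open>auto simp: comp_assoc\<close>)

lemma card_two_perm_group:
  assumes "two_perm_group A H" "finite A"
  shows "\<exists>k. card H = 2 ^ k"
proof -
  have "finite H"
    using finite_subset[OF _ finite_permutations[OF assms(2)]] two_perm_groupD(1)[OF assms(1)]
    by (metis mem_Collect_eq subsetI)
  then show ?thesis
    using group.order_prime_power_if_elements[OF two_perm_group_group[OF assms(1)], of 2]
      two_perm_groupD(4)[OF assms(1)]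
    by (simp add: order_def nat_pow_eq_funpow)
qed

lemma two_perm_group_powers:
  assumes "x permutes A" "x ^^ (2 ^ k) = id"
  shows "two_perm_group A (range (\<lambda>j. x ^^ j))"
proof -
  have "(x ^^ j) ^^ (2 ^ k) = id" for j
    using assms(2) by (metis funpow_mult mult.commute id_funpow)
  moreover have "x ^^ i \<circ> x ^^ j \<in> range (\<lambda>j. x ^^ j)" for i j
    by (metis funpow_add rangeI)
  moreover have "id \<in> range (\<lambda>j. x ^^ j)" by (metis funpow.simps(1) rangeI)
  ultimately show ?thesis
    using assms(1) by (auto simp: two_perm_group_def intro: permutes_funpow)
qed

section \<open>Pairings\<close>

text \<open>Allowing one fixed point covers sets of odd size, where exactly one point of
  \<open>A\<close> stays unpaired.\<close>

definition pairings :: "'a set \<Rightarrow> ('a \<Rightarrow> 'a) set" where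
  "pairings A = {z. z permutes A \<and> (\<forall>i. z (z i) = i) \<and> (\<forall>i\<in>A. \<forall>j\<in>A. z i = i \<longrightarrow> z j = j \<longrightarrow> i = j)}"

lemma pairing_mem: "z \<in> pairings A \<Longrightarrow> i \<in> A \<Longrightarrow> z i \<in> A"
  using permutes_in_image[of z A i] by (simp add: pairings_def)

lemma finite_pairings: "finite A \<Longrightarrow> finite (pairings A)"
  by (rule finite_subset[OF _ finite_permutations[of A]]) (auto simp: pairings_def)

lemma conj_pairing:
  assumes "g permutes A" "z \<in> pairings A"
  shows "g \<circ> z \<circ> inv' g \<in> pairings A"
proof -
  have "g \<circ> z \<circ> inv' g permutes A"
    using assms by (auto simp: pairings_def intro!: permutes_compose permutes_inv)
  moreover have "i \<in> A \<Longrightarrow> inv' g i \<in> A" for i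
    using permutes_in_image[OF permutes_inv[OF assms(1)]] by simp
  moreover have "g (z j) = i \<longleftrightarrow> z j = inv' g i" for i j
    using permutes_inverses[OF assms(1)] by metis
  moreover have "inv' g i = inv' g j \<longleftrightarrow> i = j" for i j
    using permutes_inverses[OF assms(1)] by metis
  ultimately show ?thesis
    using assms by (simp add: pairings_def permutes_inverses) metis
qed

lemma conj_eq_iff_commute:
  assumes "g permutes A"
  shows "g \<circ> z \<circ> inv' g = z \<longleftrightarrow> (\<forall>i. g (z i) = z (g i))"
proof -
  have "bij g" using assms by (rule permutes_bij)
  then have "g \<circ> z \<circ> inv' g = z \<longleftrightarrow> g \<circ> z = z \<circ> g"
    by (metis bij_is_inj bij_is_surj comp_assoc comp_id inv_o_cancel surj_iff)
  then show ?thesis by (simp add: fun_eq_iff)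
qed

text \<open>The 2-group \<open>H\<close> acts on the pairings by conjugation, and the fixed points
  of this action are the pairings that commute with all of \<open>H\<close>.\<close>

lemma card_pairings_cong_centralized:
  assumes "finite A" "two_perm_group A H"
  shows "card (pairings A) mod 2 = card {z \<in> pairings A. \<forall>h\<in>H. \<forall>i. h (z i) = z (h i)} mod 2"
proof -
  define G where "G = \<lparr>carrier = H, mult = (\<circ>), one = id :: 'a \<Rightarrow> 'a\<rparr>"
  define act where "act = (\<lambda>(h :: 'a \<Rightarrow> 'a) (z :: 'a \<Rightarrow> 'a). h \<circ> z \<circ> inv' h)"
  have perm: "h permutes A" if "h \<in> carrier G" for h
    using that two_perm_groupD(1)[OF assms(2)] by (simp add: G_def)
  obtain k where "card H = 2 ^ k" using assms card_two_perm_group by blast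
  then have ord: "order G = 2 ^ k" by (simp add: order_def G_def)
  have grp: "group G" unfolding G_def using assms two_perm_group_group by blast
  have "card (pairings A) mod 2 = card {z \<in> pairings A. \<forall>h\<in>carrier G. act h z = z} mod 2"
  proof (rule p_group_card_cong_fixed_points[OF grp two_is_prime_nat ord finite_pairings[OF assms(1)]])
    fix h z assume "h \<in> carrier G" "z \<in> pairings A"
    then show "act h z \<in> pairings A" using perm conj_pairing unfolding act_def by blast
  next
    fix g h z assume "g \<in> carrier G" "h \<in> carrier G"
    then show "act (g \<otimes>\<^bsub>G\<^esub> h) z = act g (act h z)"
      using o_inv_distrib[of g h] perm permutes_bij[of _ A]
      by (simp add: act_def G_def comp_assoc)
  next
    show "act \<one>\<^bsub>G\<^esub> z = z" for z by (simp add: act_def G_def)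
  qed
  moreover have "(\<forall>h\<in>carrier G. act h z = z) \<longleftrightarrow> (\<forall>h\<in>H. \<forall>i. h (z i) = z (h i))" for z
    using perm conj_eq_iff_commute[of _ A z] by (simp add: act_def G_def)
  ultimately show ?thesis by simp
qed

section \<open>Parity of the number of pairings\<close>

lemma permutes_subsingleton:
  assumes "p permutes A" "\<And>a b. a \<in> A \<Longrightarrow> b \<in> A \<Longrightarrow> a = b"
  shows "p = id"
proof
  fix i show "p i = id i"
    using assms(2)[of "p i" i] permutes_in_image[OF assms(1), of i] permutes_not_in[OF assms(1), of i]
    by (cases "i \<in> A") simp_all
qed

text \<open>Induction removing two points \<open>a\<close> and \<open>b\<close>: modulo 2 only the
  pairings commuting with the transposition of \<open>a\<close> and \<open>b\<close> count, and
  these correspond to the pairings of the remaining points.\<close>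

lemma odd_card_pairings:
  assumes "finite A"
  shows "odd (card (pairings A))"
  using assms
proof (induction A rule: finite_psubset_induct)
  case (psubset A)
  show ?case
  proof (cases "\<forall>a\<in>A. \<forall>b\<in>A. a = b")
    case True
    then have "pairings A = {id}"
      using permutes_subsingleton[of _ A] by (auto simp: pairings_def)
    then show ?thesis by simp
  next
    case False
    then obtain a b where ab: "a \<in> A" "b \<in> A" "a \<noteq> b" by blast
    define t where "t = transpose a b"
    have tp: "t permutes A" unfolding t_def using ab by (simp add: permutes_swap_id)
    have tt: "t \<circ> t = id" by (simp add: t_def)
    have "two_perm_group A {id, t}"
    proof -
      have "t ^^ (2 ^ 1) = id" using tt by (simp add: numeral_2_eq_2)
      moreover have "id ^^ (2 ^ 0) = (id :: 'a \<Rightarrow> 'a)" by simp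
      ultimately have "\<forall>h\<in>{id, t}. \<exists>k. h ^^ (2 ^ k) = id" by blast
      then show ?thesis
        using tp tt unfolding two_perm_group_def by auto
    qed
    then have "card (pairings A) mod 2 = card {z \<in> pairings A. \<forall>h\<in>{id, t}. \<forall>i. h (z i) = z (h i)} mod 2"
      using card_pairings_cong_centralized psubset.hyps by blast
    \<comment> \<open>A pairing that commutes with \<open>(a b)\<close> cannot fix both \<open>a\<close> and \<open>b\<close>, hence exchanges them.\<close>
    moreover have "bij_betw (\<lambda>z. t \<circ> z) {z \<in> pairings A. \<forall>h\<in>{id, t}. \<forall>i. h (z i) = z (h i)} (pairings (A - {a, b}))"
    proof (rule bij_betw_byWitness[where f' = "\<lambda>z. t \<circ> z"])
      have ttz: "t \<circ> (t \<circ> z) = z" for z :: "'a \<Rightarrow> 'a" using tt by (simp add: comp_assoc[symmetric])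
      then show "\<forall>z\<in>{z \<in> pairings A. \<forall>h\<in>{id, t}. \<forall>i. h (z i) = z (h i)}. t \<circ> (t \<circ> z) = z"
        "\<forall>z\<in>pairings (A - {a, b}). t \<circ> (t \<circ> z) = z" by auto
      show "(\<lambda>z. t \<circ> z) ` {z \<in> pairings A. \<forall>h\<in>{id, t}. \<forall>i. h (z i) = z (h i)} \<subseteq> pairings (A - {a, b})"
      proof safe
        fix z assume z: "z \<in> pairings A" and comm: "\<forall>h\<in>{id, t}. \<forall>i. h (z i) = z (h i)"
        have c: "t (z i) = z (t i)" for i using comm by blast
        have zp: "z permutes A" and zz: "\<And>i. z (z i) = i"
          and zf: "\<And>i j. i \<in> A \<Longrightarrow> j \<in> A \<Longrightarrow> z i = i \<Longrightarrow> z j = j \<Longrightarrow> i = j"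
          using z by (auto simp: pairings_def)
        have "z a = b"
          using c[of a] zf[of a b] ab zz[of a] zz[of b] unfolding t_def
          by (cases "z a = a"; cases "z a = b") (auto simp: transpose_def)
        then have "z b = a" using zz by metis
        \<comment> \<open>Composing with \<open>t\<close> cancels the exchange of \<open>a\<close>
          and \<open>b\<close> and leaves all other values of \<open>z\<close> alone.\<close>
        have val: "(t \<circ> z) i = (if i = a \<or> i = b then i else z i)" for i
        proof -
          have "z i = a \<Longrightarrow> i = b" "z i = b \<Longrightarrow> i = a"
            using \<open>z a = b\<close> \<open>z b = a\<close> zz by metis+
          then show ?thesis
            using \<open>z a = b\<close> \<open>z b = a\<close> unfolding t_def transpose_def comp_apply by presburger
        qed
        have "t \<circ> z permutes A" using zp tp permutes_compose by blast
        then have "t \<circ> z permutes (A - {a, b})"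
          by (rule permutes_superset) (use val in auto)
        moreover have "(t \<circ> z) ((t \<circ> z) i) = i" for i
          using fun_cong[OF tt, of i] zz[of i] by (simp add: c)
        moreover have "i = j" if "i \<in> A - {a, b}" "j \<in> A - {a, b}" "(t \<circ> z) i = i" "(t \<circ> z) j = j" for i j
          using that val zf by auto
        ultimately show "t \<circ> z \<in> pairings (A - {a, b})" unfolding pairings_def by blast
      qed
      show "(\<lambda>z. t \<circ> z) ` pairings (A - {a, b}) \<subseteq> {z \<in> pairings A. \<forall>h\<in>{id, t}. \<forall>i. h (z i) = z (h i)}"
      proof (rule image_subsetI)
        fix z assume z: "z \<in> pairings (A - {a, b})"
        have zp: "z permutes (A - {a, b})" and zz: "\<And>i. z (z i) = i"
          and zf: "\<And>i j. i \<in> A - {a, b} \<Longrightarrow> j \<in> A - {a, b} \<Longrightarrow> z i = i \<Longrightarrow> z j = j \<Longrightarrow> i = j"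
          using z unfolding pairings_def by blast+
        have za: "z a = a" "z b = b" using permutes_not_in[OF zp] by auto
        have zne: "z i \<noteq> a" "z i \<noteq> b" if "i \<noteq> a" "i \<noteq> b" for i
          using za zz that by metis+
        have c: "t (z i) = z (t i)" for i
          using za zne[of i] by (auto simp: t_def transpose_def)
        have "t \<circ> z permutes A"
          using permutes_compose[OF permutes_subset[OF zp] tp] by blast
        moreover have "(t \<circ> z) ((t \<circ> z) i) = i" for i
          using fun_cong[OF tt, of i] zz[of i] by (simp add: c)
        \<comment> \<open>Since \<open>t \<circ> z\<close> exchanges \<open>a\<close> and
          \<open>b\<close>, its fixed points in \<open>A\<close> are those of \<open>z\<close>
          outside \<open>{a, b}\<close>, of which there is at most one.\<close>
        moreover have "i \<in> A - {a, b} \<and> z i = i" if "i \<in> A" "(t \<circ> z) i = i" for i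
          using that ab za zne[of i] by (auto simp: t_def transpose_def split: if_splits)
        ultimately have "t \<circ> z \<in> pairings A" unfolding pairings_def using zf by blast
        moreover have "\<forall>h\<in>{id, t}. \<forall>i. h ((t \<circ> z) i) = (t \<circ> z) (h i)"
          using c by auto
        ultimately show "t \<circ> z \<in> {z \<in> pairings A. \<forall>h\<in>{id, t}. \<forall>i. h (z i) = z (h i)}" by blast
      qed
    qed
    then have "card {z \<in> pairings A. \<forall>h\<in>{id, t}. \<forall>i. h (z i) = z (h i)} = card (pairings (A - {a, b}))"
      by (rule bij_betw_same_card)
    moreover have "odd (card (pairings (A - {a, b})))"
      using ab by (intro psubset.IH) auto
    ultimately show ?thesis by (simp add: odd_iff_mod_2_eq_one)
  qed
qed

lemma two_perm_group_centralizes_pairing: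
  assumes "finite A" "two_perm_group A H"
  obtains z where "z \<in> pairings A" "\<And>h i. h \<in> H \<Longrightarrow> h (z i) = z (h i)"
proof -
  have "odd (card {z \<in> pairings A. \<forall>h\<in>H. \<forall>i. h (z i) = z (h i)})"
    using odd_card_pairings[OF assms(1)] card_pairings_cong_centralized[OF assms]
    by (simp add: odd_iff_mod_2_eq_one)
  then have "{z \<in> pairings A. \<forall>h\<in>H. \<forall>i. h (z i) = z (h i)} \<noteq> {}" by fastforce
  then show thesis using that by blast
qed

text \<open>On \<open>{1..n}\<close> this is the condition of the theorem; a general set is allowed
  so that the induction can pass to the set of pairs.\<close>

definition distinct_cycles :: "'a set \<Rightarrow> ('a \<Rightarrow> 'a) \<Rightarrow> bool" where
  "distinct_cycles A x \<longleftrightarrow> card {i \<in> A. x i = i} \<le> 2 \<and>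
     (\<forall>i\<in>A. \<forall>j\<in>A. x i \<noteq> i \<longrightarrow> x j \<noteq> j \<longrightarrow>
        card (Orbits.orbit x i) = card (Orbits.orbit x j) \<longrightarrow> Orbits.orbit x i = Orbits.orbit x j)"

section \<open>Pairings commuting with a permutation of distinct cycle lengths\<close>

context
  fixes A :: "'a set" and x z :: "'a \<Rightarrow> 'a"
  assumes fin: "finite A" and x: "x permutes A" and dist: "distinct_cycles A x"
    and z: "z \<in> pairings A" and comm: "\<And>i. x (z i) = z (x i)"
begin

text \<open>As \<open>z\<close> commutes with \<open>x\<close>, it carries the orbit of
  \<open>i\<close> to a nontrivial orbit of the same length, which must be the same orbit. If
  \<open>z\<close> fixed \<open>i\<close>, it would also fix \<open>x i\<close>, a second fixed
  point.\<close>

lemma pairing_mem_orbit: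
  assumes "i \<in> A" "x i \<noteq> i"
  shows "z i \<in> Orbits.orbit x i" "z i \<noteq> i"
proof -
  have perm: "permutation x" using x fin permutation_permutes by blast
  have zz: "z (z i) = i" for i using z by (simp add: pairings_def)
  then have inj: "inj z" by (metis injI)
  have zA: "z i \<in> A" by (rule pairing_mem[OF z assms(1)])
  have "x (z i) \<noteq> z i" using comm[of i] assms(2) injD[OF inj, of "x i" i] by auto
  moreover have "card (Orbits.orbit x (z i)) = card (Orbits.orbit x i)"
    using image_orbit_commute[OF perm, where s = z and i = i] comm
      card_image[OF inj_on_subset[OF inj subset_UNIV]] by metis
  ultimately show "z i \<in> Orbits.orbit x i"
    using dist assms zA orbit_eq_iff_mem[OF perm] unfolding distinct_cycles_def by metis
  show "z i \<noteq> i"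
  proof
    assume "z i = i"
    then have "z (x i) = x i" using comm[of i] by simp
    moreover have "x i \<in> A" using assms(1) permutes_in_image[OF x] by simp
    ultimately have "i = x i" using \<open>z i = i\<close> assms(1) z unfolding pairings_def by blast
    then show False using assms by simp
  qed
qed

text \<open>Write \<open>z i\<close> as \<open>(x ^^ k) i\<close> and let \<open>m\<close> be the
  orbit length. Then \<open>m\<close> divides \<open>2 * k\<close> but not \<open>k\<close>, so
  \<open>m\<close> is even and \<open>k\<close> is an odd multiple of
  \<open>m div 2\<close>.\<close>

lemma pairing_eq_half_cycle:
  assumes "i \<in> A" "x i \<noteq> i"
  shows "z i = (x ^^ (card (Orbits.orbit x i) div 2)) i"
proof -
  define m where "m = card (Orbits.orbit x i)"
  have perm: "permutation x" using x fin permutation_permutes by blast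
  obtain k where k: "z i = (x ^^ k) i"
    using pairing_mem_orbit[OF assms] mem_orbit_iff_funpow[OF perm] by blast
  have "z (z i) = i" using z by (simp add: pairings_def)
  then have "(x ^^ (k + k)) i = i"
    using k funpow_commute[of x z k i] comm by (simp add: funpow_add)
  then have "m dvd k + k" using funpow_fix_iff_card_orbit_dvd[OF perm] by (simp add: m_def)
  then obtain q where q: "2 * k = m * q" by (metis dvd_def mult_2)
  have "\<not> m dvd k"
    using pairing_mem_orbit(2)[OF assms] k funpow_fix_iff_card_orbit_dvd[OF perm] by (simp add: m_def)
  have "odd q"
  proof
    assume "even q"
    then obtain r where "q = 2 * r" by blast
    then have "k = m * r" using q by simp
    then show False using \<open>\<not> m dvd k\<close> by simp
  qed
  then obtain r where r: "q = 2 * r + 1" using oddE by blast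
  have "even (m * q)" using q by (metis dvd_triv_left)
  then have "even m" using \<open>odd q\<close> by simp
  then obtain l where l: "m = 2 * l" by blast
  then have "k = l + m * r" using q r by (simp add: algebra_simps)
  then have "k mod m = (m div 2) mod m" using l by simp
  then show ?thesis
    using k funpow_eq_iff_mod_card_orbit[OF perm] by (simp add: m_def)
qed

text \<open>There are no further fixed points of \<open>x\<close>, so \<open>z\<close> preserves
  \<open>{i, j}\<close>, and it cannot fix both points.\<close>

lemma pairing_swaps_fixed_points:
  assumes "i \<in> A" "j \<in> A" "x i = i" "x j = j" "i \<noteq> j"
  shows "z i = j"
proof -
  have "{i, j} \<subseteq> {i \<in> A. x i = i}" using assms by auto
  moreover have "card {i \<in> A. x i = i} \<le> card {i, j}"
    using dist assms by (simp add: distinct_cycles_def)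
  ultimately have eq: "{i \<in> A. x i = i} = {i, j}"
    using fin card_seteq[of "{i \<in> A. x i = i}" "{i, j}"] by auto
  have "z k \<in> {i, j}" if "k \<in> {i, j}" for k
  proof -
    have "k \<in> A" using that assms by auto
    then have "z k \<in> A" by (rule pairing_mem[OF z])
    moreover have "x (z k) = z k" using comm[of k] that assms by auto
    ultimately show ?thesis using eq by blast
  qed
  then have "z i \<in> {i, j}" "z j \<in> {i, j}" by auto
  moreover have "z (z i) = i" "z (z j) = j" using z by (auto simp: pairings_def)
  moreover have "\<not> (z i = i \<and> z j = j)" using z assms by (auto simp: pairings_def)
  ultimately show ?thesis by (metis insertE singletonD)
qed

lemma pairing_fixes_single_fixed_point:
  assumes "i \<in> A" "x i = i" "\<And>j. j \<in> A \<Longrightarrow> x j = j \<Longrightarrow> j = i"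
  shows "z i = i"
  using assms(3)[OF pairing_mem[OF z assms(1)]] comm[of i] assms(2) by simp

end

text \<open>\<open>x\<close> alone determines the pairing, so the pairings centralized by different
  2-groups containing \<open>x\<close> coincide. The cases are: outside \<open>A\<close>, on a
  nontrivial cycle, one of two fixed points, the only fixed point.\<close>

lemma commuting_pairing_unique:
  assumes "finite A" "x permutes A" "distinct_cycles A x"
    and "z \<in> pairings A" "\<And>i. x (z i) = z (x i)"
    and "w \<in> pairings A" "\<And>i. x (w i) = w (x i)"
  shows "z = w"
proof
  fix i
  consider "i \<notin> A" | "i \<in> A" "x i \<noteq> i" | j where "i \<in> A" "x i = i" "j \<in> A" "x j = j" "i \<noteq> j"
    | "i \<in> A" "x i = i" "\<And>j. j \<in> A \<Longrightarrow> x j = j \<Longrightarrow> j = i" by metis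
  then show "z i = w i"
  proof cases
    case 1
    then show ?thesis
      using assms(4,6) permutes_not_in[of z A i] permutes_not_in[of w A i] by (simp add: pairings_def)
  next
    case 2
    then show ?thesis
      using pairing_eq_half_cycle[where x = x and z = z, OF assms(1-5), of i]
        pairing_eq_half_cycle[where x = x and z = w, OF assms(1-3,6,7), of i]
      by simp
  next
    case 3
    then show ?thesis
      using pairing_swaps_fixed_points[where x = x and z = z, OF assms(1-5), of i j]
        pairing_swaps_fixed_points[where x = x and z = w, OF assms(1-3,6,7), of i j] by simp
  next
    case 4
    then show ?thesis
      using pairing_fixes_single_fixed_point[where x = x and z = z, OF assms(1-5), of i]
        pairing_fixes_single_fixed_point[where x = x and z = w, OF assms(1-3,6,7), of i] by metis
  qed
qed

section \<open>Passing to the pairs of an involution\<close>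

text \<open>Any number of fixed points is allowed: the involution for the converse direction fixes
  everything outside two orbits.\<close>

locale involution =
  fixes A :: "'a::linorder set" and s :: "'a \<Rightarrow> 'a"
  assumes fin: "finite A" and perm: "s permutes A" and invol [simp]: "s (s i) = i"
begin

text \<open>Representing each pair \<open>{i, s i}\<close> by its minimum keeps the induced permutations on the type
  of the original ones, which the induction over the set needs.\<close>

definition rep :: "'a \<Rightarrow> 'a" where "rep i = min i (s i)"

definition reps :: "'a set" where "reps = {i \<in> A. i \<le> s i}"

definition centralizer :: "('a \<Rightarrow> 'a) set" where
  "centralizer = {g. g permutes A \<and> (\<forall>i. g (s i) = s (g i))}"

text \<open>The action of \<open>g\<close> on the pairs, transported to their minima and extended by
  the identity so that it permutes \<open>reps\<close>.\<close>

definition quot :: "('a \<Rightarrow> 'a) \<Rightarrow> 'a \<Rightarrow> 'a" where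
  "quot g i = (if i \<in> reps then rep (g i) else i)"

text \<open>The full preimage of \<open>M\<close> under \<open>quot\<close> in the centralizer of
  \<open>s\<close>.\<close>

definition lift :: "('a \<Rightarrow> 'a) set \<Rightarrow> ('a \<Rightarrow> 'a) set" where
  "lift M = {g \<in> centralizer. quot g \<in> M}"

lemma s_eq_iff: "s i = j \<longleftrightarrow> i = s j"
  by auto

lemma s_mem_iff: "s i \<in> A \<longleftrightarrow> i \<in> A"
  by (rule permutes_in_image[OF perm])

lemma rep_cases: "rep i = i \<or> rep i = s i"
  by (simp add: rep_def min_def)

lemma rep_s: "rep (s i) = rep i"
  by (simp add: rep_def min.commute)

lemma rep_eq_iff: "rep i = rep j \<longleftrightarrow> i = j \<or> i = s j"
proof
  assume "rep i = rep j"
  then show "i = j \<or> i = s j"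
    using rep_cases[of i] rep_cases[of j] s_eq_iff[of i j] s_eq_iff[of i "s j"] by auto
qed (auto simp: rep_s)

lemma finite_reps: "finite reps"
  using fin by (simp add: reps_def)

lemma rep_mem: "i \<in> A \<Longrightarrow> rep i \<in> reps"
  using linear[of i "s i"]
  by (cases "i \<le> s i") (simp_all add: rep_def reps_def min_def s_mem_iff)

lemma rep_id: "i \<in> reps \<Longrightarrow> rep i = i"
  by (simp add: rep_def reps_def)

lemma reps_mem: "i \<in> reps \<Longrightarrow> i \<in> A"
  by (simp add: reps_def)

lemma reps_eq: "i \<in> reps \<Longrightarrow> j \<in> reps \<Longrightarrow> i = s j \<Longrightarrow> i = j"
  by (auto simp: reps_def)

section \<open>Permutations commuting with the involution and their action on pairs\<close>

lemma centralizerD: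
  assumes "g \<in> centralizer"
  shows "g permutes A" "g (s i) = s (g i)" "i \<in> A \<Longrightarrow> g i \<in> A" "g i = g j \<Longrightarrow> i = j"
proof -
  show g: "g permutes A" "g (s i) = s (g i)" using assms by (auto simp: centralizer_def)
  show "i \<in> A \<Longrightarrow> g i \<in> A" using permutes_in_image[OF g(1)] by simp
  show "g i = g j \<Longrightarrow> i = j" using permutes_inj[OF g(1)] by (rule injD)
qed

lemma id_centralizer: "id \<in> centralizer"
  by (simp add: centralizer_def)

lemma comp_centralizer: "g \<in> centralizer \<Longrightarrow> h \<in> centralizer \<Longrightarrow> g \<circ> h \<in> centralizer"
  by (simp add: centralizer_def permutes_compose)

lemma funpow_centralizer: "g \<in> centralizer \<Longrightarrow> g ^^ k \<in> centralizer"
  by (induction k) (simp_all only: funpow.simps id_centralizer comp_centralizer)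

lemma rep_apply_rep: "g \<in> centralizer \<Longrightarrow> rep (g (rep i)) = rep (g i)"
  using rep_cases[of i] centralizerD(2)[of g i] rep_s[of "g i"] by auto

lemma quot_rep: "g \<in> centralizer \<Longrightarrow> i \<in> A \<Longrightarrow> quot g (rep i) = rep (g i)"
  by (simp add: quot_def rep_mem rep_apply_rep)

text \<open>If the images of two points under \<open>g\<close> lie in one pair, so do the points;
  injectivity suffices because \<open>reps\<close> is finite.\<close>

lemma quot_permutes:
  assumes "g \<in> centralizer"
  shows "quot g permutes reps"
proof -
  note g = centralizerD[OF assms]
  have "inj_on (quot g) reps"
  proof (rule inj_onI)
    fix i j assume ij: "i \<in> reps" "j \<in> reps" "quot g i = quot g j"
    then have "g i = g j \<or> g i = g (s j)" by (simp add: quot_def rep_eq_iff g(2))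
    then have "i = j \<or> i = s j" using g(4) by blast
    then show "i = j" using ij reps_eq by blast
  qed
  moreover have "quot g ` reps \<subseteq> reps"
    by (auto simp: quot_def intro!: rep_mem g(3) dest: reps_mem)
  ultimately have "bij_betw (quot g) reps reps"
    using endo_inj_surj[OF finite_reps] by (simp add: bij_betw_def)
  then show ?thesis by (rule bij_imp_permutes) (simp add: quot_def)
qed

lemma quot_id: "quot id = id"
  by (auto simp: quot_def rep_id)

lemma quot_comp:
  assumes "g \<in> centralizer" "h \<in> centralizer"
  shows "quot (g \<circ> h) = quot g \<circ> quot h"
proof
  fix i
  show "quot (g \<circ> h) i = (quot g \<circ> quot h) i"
  proof (cases "i \<in> reps")
    case True
    then have "h i \<in> A" by (intro centralizerD(3)[OF assms(2)] reps_mem)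
    then show ?thesis using True quot_rep[OF assms(1), of "h i"] by (simp add: quot_def)
  qed (simp add: quot_def)
qed

lemma quot_funpow: "g \<in> centralizer \<Longrightarrow> quot (g ^^ k) = quot g ^^ k"
proof (induction k)
  case 0 then show ?case by (simp only: funpow.simps quot_id)
next
  case (Suc k)
  then show ?case by (simp only: funpow.simps quot_comp funpow_centralizer)
qed

text \<open>An element acting trivially on the pairs squares to the identity, so passing from
  \<open>quot g\<close> to \<open>g\<close> at most doubles the exponent.\<close>

lemma two_perm_group_lift:
  assumes M: "two_perm_group reps M"
  shows "two_perm_group A (lift M)"
  unfolding two_perm_group_def
proof (intro conjI ballI)
  show "id \<in> lift M" using two_perm_groupD[OF M] by (simp add: lift_def quot_id id_centralizer)
next
  fix g h assume "g \<in> lift M" "h \<in> lift M"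
  then show "g \<circ> h \<in> lift M"
    using two_perm_groupD[OF M] by (simp add: lift_def quot_comp comp_centralizer)
next
  fix g assume g: "g \<in> lift M"
  then have gc: "g \<in> centralizer" by (simp add: lift_def)
  then show "g permutes A" by (rule centralizerD)
  obtain k where k: "quot g ^^ (2 ^ k) = id"
    using two_perm_groupD(4)[OF M] g by (auto simp: lift_def)
  define h where "h = g ^^ (2 ^ k)"
  have h: "h \<in> centralizer" using gc by (simp add: h_def funpow_centralizer)
  have "quot h = id" using k gc by (simp add: h_def quot_funpow)
  \<comment> \<open>\<open>h i\<close> is \<open>i\<close> or \<open>s i\<close>, and
    \<open>h\<close> commutes with \<open>s\<close>.\<close>
  then have "h (h i) = i" if "i \<in> A" for i
    using quot_rep[OF h that] rep_eq_iff[of i "h i"] centralizerD(2)[OF h, of i]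
    by (metis id_apply invol)
  then have "h \<circ> h = id"
    using permutes_not_in[OF centralizerD(1)[OF h]] by (metis comp_apply eq_id_iff)
  then have "g ^^ (2 ^ Suc k) = id"
    by (simp add: h_def funpow_add[symmetric] mult_2)
  then show "\<exists>k. g ^^ (2 ^ k) = id" by blast
qed

lemma two_perm_group_quot:
  assumes Q: "two_perm_group A Q" "Q \<subseteq> centralizer"
  shows "two_perm_group reps (quot ` Q)"
  unfolding two_perm_group_def
proof (intro conjI ballI)
  show "id \<in> quot ` Q" using two_perm_groupD[OF Q(1)] quot_id by (metis imageI)
next
  fix g h assume "g \<in> quot ` Q" "h \<in> quot ` Q"
  then show "g \<circ> h \<in> quot ` Q"
    using two_perm_groupD(3)[OF Q(1)] Q(2) quot_comp by (auto simp: image_iff) (metis subsetD)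
next
  fix h assume "h \<in> quot ` Q"
  then obtain g where g: "g \<in> Q" "h = quot g" by blast
  then show "h permutes reps" using Q(2) quot_permutes by blast
  obtain k where "g ^^ (2 ^ k) = id" using two_perm_groupD(4)[OF Q(1)] g by blast
  then have "h ^^ (2 ^ k) = id" using g Q(2) quot_funpow quot_id by (metis subsetD)
  then show "\<exists>k. h ^^ (2 ^ k) = id" by blast
qed

section \<open>Cycle lengths on the set of pairs\<close>

lemma orbit_quot:
  assumes "g \<in> centralizer" "i \<in> A"
  shows "Orbits.orbit (quot g) (rep i) = rep ` Orbits.orbit g i"
proof -
  have "permutation g" using centralizerD(1)[OF assms(1)] fin permutation_permutes by blast
  then have "i \<in> Orbits.orbit g i" by (rule permutation_self_in_orbit)
  moreover have "quot g (rep j) = rep (g j)" if "j \<in> Orbits.orbit g i" for j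
    using that permutes_orbit_subset[OF centralizerD(1)[OF assms(1)] assms(2)]
    by (blast intro: quot_rep[OF assms(1)])
  ultimately show ?thesis using orbit_inverse[where f = rep and g = g and g' = "quot g" and a = i] by simp
qed

text \<open>The orbit is invariant under \<open>s\<close> and contains no fixed point of
  \<open>s\<close>, so it is a disjoint union of pairs, each contributing one minimum.\<close>

lemma card_orbit_quot:
  assumes g: "g \<in> centralizer" and i: "i \<in> A" and si: "s i \<in> Orbits.orbit g i" "s i \<noteq> i"
  shows "card (Orbits.orbit g i) = 2 * card (rep ` Orbits.orbit g i)"
proof -
  let ?O = "Orbits.orbit g i"
  have pg: "permutation g" using centralizerD(1)[OF g] fin permutation_permutes by blast
  have "s ` ?O = Orbits.orbit g (s i)"
    by (rule image_orbit_commute[OF pg]) (rule centralizerD(2)[OF g])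
  then have sO: "s ` ?O = ?O" using si orbit_eq_iff_mem[OF pg] by metis
  \<comment> \<open>Powers of \<open>g\<close> commute with \<open>s\<close>, so one fixed point of
    \<open>s\<close> in the orbit would make \<open>i\<close> fixed as well.\<close>
  have ne: "s j \<noteq> j" if j: "j \<in> ?O" for j
  proof
    assume "s j = j"
    obtain k where "j = (g ^^ k) i" using j mem_orbit_iff_funpow[OF pg] by blast
    then have "(g ^^ k) (s i) = (g ^^ k) i"
      using \<open>s j = j\<close> centralizerD(2)[OF funpow_centralizer[OF g], of k i] by simp
    then have "s i = i" by (rule centralizerD(4)[OF funpow_centralizer[OF g]])
    then show False using si by simp
  qed
  have s_closed: "s k \<in> ?O" if "k \<in> ?O" for k using sO that by blast
  have rep_closed: "rep k \<in> ?O" if "k \<in> ?O" for k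
    using rep_cases[of k] s_closed[OF that] that by auto
  have split: "?O = rep ` ?O \<union> s ` rep ` ?O"
  proof
    show "?O \<subseteq> rep ` ?O \<union> s ` rep ` ?O"
    proof
      fix j assume j: "j \<in> ?O"
      have "j = rep j \<or> j = s (rep j)" using rep_cases[of j] by auto
      then show "j \<in> rep ` ?O \<union> s ` rep ` ?O" using j by blast
    qed
    show "rep ` ?O \<union> s ` rep ` ?O \<subseteq> ?O" using s_closed rep_closed by blast
  qed
  have disj: "rep ` ?O \<inter> s ` rep ` ?O = {}"
  proof -
    have "False" if jk: "j \<in> ?O" "k \<in> ?O" "rep j = s (rep k)" for j k
    proof -
      have "j \<in> A" "k \<in> A"
        using jk permutes_orbit_subset[OF centralizerD(1)[OF g] i] by auto
      then have "rep j = rep k" using reps_eq[OF rep_mem rep_mem jk(3)] by simp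
      then show False using ne[OF rep_closed[OF jk(2)]] jk(3) by simp
    qed
    then show ?thesis by blast
  qed
  have fin_rep: "finite (rep ` ?O)"
    by (intro finite_imageI finite_orbit permutation_self_in_orbit[OF pg])
  have "card (s ` rep ` ?O) = card (rep ` ?O)"
    by (rule card_image) (rule inj_on_inverseI[of _ s], simp)
  then have "card (rep ` ?O \<union> s ` rep ` ?O) = 2 * card (rep ` ?O)"
    using card_Un_disjoint[OF fin_rep finite_imageI[OF fin_rep] disj] by (simp only: mult_2)
  then show ?thesis by (simp only: split[symmetric])
qed

text \<open>The nontrivial cycles of \<open>quot x\<close> come from cycles of \<open>x\<close> of
  exactly twice the length, so their lengths stay distinct. A pair fixed by \<open>quot x\<close>
  consists of fixed points of \<open>x\<close> or is a 2-cycle of \<open>x\<close>, and at most one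
  pair of each kind exists.\<close>

lemma distinct_cycles_quot:
  assumes s: "s \<in> pairings A" and x: "x \<in> centralizer" and dist: "distinct_cycles A x"
  shows "distinct_cycles reps (quot x)"
proof -
  note xp = centralizerD(1)[OF x]
  note facts = fin xp dist s centralizerD(2)[OF x]
  \<comment> \<open>\<open>S\<close> collects the minima of pairs fixed pointwise by
    \<open>x\<close>, \<open>T\<close> those of pairs that \<open>x\<close> exchanges.\<close>
  define S T where "S = {i \<in> reps. x i = i}" and "T = {i \<in> reps. x i = s i \<and> x i \<noteq> i}"
  \<comment> \<open>Two fixed points of \<open>x\<close> are exchanged by \<open>s\<close>, so they
    form a single pair with a single minimum.\<close>
  have "i = j" if "i \<in> S" "j \<in> S" for i j
  proof (rule ccontr)
    assume "i \<noteq> j"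
    then have "s i = j"
      using that pairing_swaps_fixed_points[where x = x and z = s, OF facts, of i j] reps_mem
      by (simp add: S_def)
    then have "j = s i" by (rule sym)
    moreover have "i \<in> reps" "j \<in> reps" using that by (simp_all add: S_def)
    ultimately have "j = i" using reps_eq[of j i] by blast
    then show False using \<open>i \<noteq> j\<close> by simp
  qed
  moreover have "finite S" using finite_reps by (simp add: S_def)
  ultimately have "card S \<le> 1" using card_le_Suc0_iff_eq[of S] unfolding One_nat_def by blast
  \<comment> \<open>On \<open>T\<close> the permutation \<open>x\<close> agrees with
    \<open>s\<close>, so the orbit is a 2-cycle; distinct lengths leave only one such orbit.\<close>
  have orbT: "Orbits.orbit x i = {i, s i}" "i \<noteq> s i" if "i \<in> T" for i
  proof -
    have "(x ^^ 2) i = i"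
      using that centralizerD(2)[OF x, of i] by (simp add: T_def numeral_2_eq_2)
    then have "Orbits.orbit x i = {(x ^^ m) i | m. m < 2}"
      by (rule orbit_altdef_bounded) simp
    also have "\<dots> = (\<lambda>m. (x ^^ m) i) ` {..<2}" by blast
    also have "\<dots> = {i, x i}" by (simp add: lessThan_Suc numeral_2_eq_2 insert_commute)
    finally show "Orbits.orbit x i = {i, s i}" "i \<noteq> s i" using that by (auto simp: T_def)
  qed
  have "i = j" if ij: "i \<in> T" "j \<in> T" for i j
  proof -
    have "card (Orbits.orbit x i) = card (Orbits.orbit x j)" using orbT ij by simp
    then have "Orbits.orbit x i = Orbits.orbit x j"
      using dist ij reps_mem unfolding distinct_cycles_def T_def by blast
    then have "i = j \<or> i = s j" using orbT(1) ij by blast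
    moreover have "i \<in> reps" "j \<in> reps" using ij by (simp_all add: T_def)
    ultimately show ?thesis using reps_eq[of i j] by blast
  qed
  moreover have "finite T" using finite_reps by (simp add: T_def)
  ultimately have "card T \<le> 1" using card_le_Suc0_iff_eq[of T] unfolding One_nat_def by blast
  have "{i \<in> reps. quot x i = i} \<subseteq> S \<union> T"
  proof
    fix i assume i: "i \<in> {i \<in> reps. quot x i = i}"
    then have "rep (x i) = i" by (auto simp: quot_def)
    then have "x i = i \<or> x i = s i" using rep_cases[of "x i"] s_eq_iff[of "x i" i] by metis
    then show "i \<in> S \<union> T" using i unfolding S_def T_def by blast
  qed
  then have "card {i \<in> reps. quot x i = i} \<le> card (S \<union> T)"
    using \<open>finite S\<close> \<open>finite T\<close> by (intro card_mono) simp_all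
  also have "\<dots> \<le> 2" using card_Un_le[of S T] \<open>card S \<le> 1\<close> \<open>card T \<le> 1\<close> by linarith
  finally have "card {i \<in> reps. quot x i = i} \<le> 2" .
  moreover have "Orbits.orbit (quot x) i = Orbits.orbit (quot x) j"
    if i: "i \<in> reps" "quot x i \<noteq> i" and j: "j \<in> reps" "quot x j \<noteq> j"
      and card: "card (Orbits.orbit (quot x) i) = card (Orbits.orbit (quot x) j)" for i j
  proof -
    have x_ne: "x i \<noteq> i" "x j \<noteq> j" using i j by (auto simp: quot_def rep_id)
    have mem: "i \<in> A" "j \<in> A" using i j reps_mem by blast+
    have orb: "Orbits.orbit (quot x) i = rep ` Orbits.orbit x i"
      "Orbits.orbit (quot x) j = rep ` Orbits.orbit x j"
      using orbit_quot[OF x mem(1)] orbit_quot[OF x mem(2)] rep_id[OF i(1)] rep_id[OF j(1)]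
      by simp_all
    note pair = pairing_mem_orbit[where x = x and z = s, OF facts]
    have "card (Orbits.orbit x i) = card (Orbits.orbit x j)"
      using card card_orbit_quot[OF x mem(1) pair[OF mem(1) x_ne(1)]]
        card_orbit_quot[OF x mem(2) pair[OF mem(2) x_ne(2)]] orb by simp
    then have "Orbits.orbit x i = Orbits.orbit x j"
      using dist x_ne mem unfolding distinct_cycles_def by blast
    then show ?thesis using orb by simp
  qed
  ultimately show ?thesis unfolding distinct_cycles_def by blast
qed

end

section \<open>The greatest 2-group containing a permutation\<close>

lemma two_perm_group_trivial: "two_perm_group A {id}"
  unfolding two_perm_group_def by simp

text \<open>The greatest 2-group is the lift of the greatest one for \<open>quot x\<close> on the
  smaller set \<open>reps\<close>.\<close>

lemma ex_greatest_two_perm_group: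
  fixes A :: "'a::linorder set"
  assumes "finite A" "x permutes A" "distinct_cycles A x"
  shows "\<exists>M. two_perm_group A M \<and> (\<forall>Q. two_perm_group A Q \<longrightarrow> x \<in> Q \<longrightarrow> Q \<subseteq> M)"
  using assms
proof (induction A arbitrary: x rule: finite_psubset_induct)
  case (psubset A)
  show ?case
  \<comment> \<open>Degenerate cases: on at most one point the identity is the only permutation, and
    if no 2-group contains \<open>x\<close> the bound is vacuous.\<close>
  proof (cases "(\<forall>a\<in>A. \<forall>b\<in>A. a = b) \<or> \<not> (\<exists>Q. two_perm_group A Q \<and> x \<in> Q)")
    case True
    have "Q \<subseteq> {id}" if Q: "two_perm_group A Q" "x \<in> Q" for Q
    proof -
      have "a = b" if "a \<in> A" "b \<in> A" for a b using True Q that by blast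
      then have "h = id" if "h \<in> Q" for h
        using permutes_subsingleton[OF two_perm_groupD(1)[OF Q(1) that]] by blast
      then show ?thesis by blast
    qed
    then show ?thesis using two_perm_group_trivial[of A] by blast
  next
    case False
    then obtain a b Q where ab: "a \<in> A" "b \<in> A" "a \<noteq> b" and Q: "two_perm_group A Q" "x \<in> Q"
      by blast
    obtain s where s: "s \<in> pairings A" "\<And>h i. h \<in> Q \<Longrightarrow> h (s i) = s (h i)"
      using two_perm_group_centralizes_pairing[OF psubset.hyps Q(1)] by blast
    interpret involution A s
      using psubset.hyps s(1) by unfold_locales (simp_all add: pairings_def)
    have x: "x \<in> centralizer"
      using psubset.prems(1) s(2)[OF Q(2)] by (simp add: centralizer_def)
    \<comment> \<open>On a set with two points a pairing moves some \<open>c\<close>, and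
      \<open>c\<close> and \<open>s c\<close> are not both minima.\<close>
    have "reps \<subset> A"
    proof -
      obtain c where c: "c \<in> A" "s c \<noteq> c" using ab s(1) unfolding pairings_def by blast
      have "c \<notin> reps \<or> s c \<notin> reps"
        using reps_eq[of "s c" c] c(2) by blast
      then show ?thesis using c(1) s_mem_iff[of c] reps_mem by blast
    qed
    then obtain M where M: "two_perm_group reps M"
      "\<And>Q. two_perm_group reps Q \<Longrightarrow> quot x \<in> Q \<Longrightarrow> Q \<subseteq> M"
      using psubset.IH[of reps "quot x"] quot_permutes[OF x]
        distinct_cycles_quot[OF s(1) x psubset.prems(2)] by blast
    have "P \<subseteq> lift M" if P: "two_perm_group A P" "x \<in> P" for P
    proof -
      obtain z where z: "z \<in> pairings A" "\<And>h i. h \<in> P \<Longrightarrow> h (z i) = z (h i)"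
        using two_perm_group_centralizes_pairing[OF psubset.hyps P(1)] by blast
      \<comment> \<open>Although \<open>s\<close> was obtained from \<open>Q\<close>, uniqueness of
        the pairing commuting with \<open>x\<close> shows that \<open>P\<close> centralizes it
        too.\<close>
      have "z = s"
        using commuting_pairing_unique[where x = x and z = z and w = s,
            OF psubset.hyps psubset.prems z(1) z(2)[OF P(2)] s(1) s(2)[OF Q(2)]] .
      then have sub: "P \<subseteq> centralizer"
        using z(2) two_perm_groupD(1)[OF P(1)] by (auto simp: centralizer_def)
      have "quot x \<in> quot ` P" using P(2) by (rule imageI)
      then have "quot ` P \<subseteq> M" by (rule M(2)[OF two_perm_group_quot[OF P(1) sub]])
      then show ?thesis using sub unfolding lift_def by blast
    qed
    then show ?thesis using two_perm_group_lift[OF M(1)] by blast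
  qed
qed

section \<open>Transpositions in a 2-group\<close>

text \<open>Matching \<open>(x ^^ k) a\<close> with \<open>(x ^^ k) b\<close> is well defined
  because both orbits have the same length, and it commutes with \<open>x\<close> since
  \<open>x\<close> raises \<open>k\<close> by one on both sides.\<close>

lemma ex_involution_swapping_orbits:
  assumes "finite A" "x permutes A" "a \<in> A" "b \<in> A"
    and ne: "Orbits.orbit x a \<noteq> Orbits.orbit x b"
    and card: "card (Orbits.orbit x a) = card (Orbits.orbit x b)"
  obtains s where "s permutes A" "\<And>i. s (s i) = i" "\<And>i. x (s i) = s (x i)" "s a = b"
proof -
  have px: "permutation x" using assms(1,2) permutation_permutes by blast
  \<comment> \<open>\<open>funpow_dist\<close> selects one exponent for each point of an orbit;
    \<open>sa\<close> and \<open>sb\<close> show that the choice is immaterial.\<close>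
  define s where "s i = (if i \<in> Orbits.orbit x a then (x ^^ funpow_dist x a i) b
    else if i \<in> Orbits.orbit x b then (x ^^ funpow_dist x b i) a else i)" for i
  have mem: "(x ^^ k) c \<in> Orbits.orbit x c" for k c
    using mem_orbit_iff_funpow[OF px] by blast
  have disj: "i \<notin> Orbits.orbit x a" if "i \<in> Orbits.orbit x b" for i
    using that ne orbit_eq_iff_mem[OF px, of a i] orbit_eq_iff_mem[OF px, of b i] by blast
  have dist: "(x ^^ funpow_dist x c ((x ^^ k) c)) c = (x ^^ k) c" for c k
    by (rule funpow_dist_prop[OF mem])
  have sa: "s ((x ^^ k) a) = (x ^^ k) b" for k
  proof -
    have "s ((x ^^ k) a) = (x ^^ funpow_dist x a ((x ^^ k) a)) b"
      unfolding s_def using mem by simp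
    also have "\<dots> = (x ^^ k) b"
      using dist[of a k] funpow_eq_iff_mod_card_orbit[OF px, of _ a k] card
        funpow_eq_iff_mod_card_orbit[OF px, of _ b k] by simp
    finally show ?thesis .
  qed
  have sb: "s ((x ^^ k) b) = (x ^^ k) a" for k
  proof -
    have "s ((x ^^ k) b) = (x ^^ funpow_dist x b ((x ^^ k) b)) a"
      unfolding s_def using mem disj[OF mem] by simp
    also have "\<dots> = (x ^^ k) a"
      using dist[of b k] funpow_eq_iff_mod_card_orbit[OF px, of _ b k] card
        funpow_eq_iff_mod_card_orbit[OF px, of _ a k] by simp
    finally show ?thesis .
  qed
  have sc: "s i = i" if "i \<notin> Orbits.orbit x a" "i \<notin> Orbits.orbit x b" for i
    using that by (simp add: s_def)
  have cases: thesis
    if "\<And>k. i = (x ^^ k) a \<Longrightarrow> thesis" "\<And>k. i = (x ^^ k) b \<Longrightarrow> thesis"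
      "i \<notin> Orbits.orbit x a \<Longrightarrow> i \<notin> Orbits.orbit x b \<Longrightarrow> thesis" for i thesis
    using that mem_orbit_iff_funpow[OF px, of i] by blast
  have ss: "s (s i) = i" for i
    by (rule cases[of i]) (simp_all add: sa sb sc)
  have sx: "x (s i) = s (x i)" for i
  proof (rule cases[of i])
    fix k assume "i = (x ^^ k) a"
    then show ?thesis using sa[of k] sa[of "Suc k"] by simp
  next
    fix k assume "i = (x ^^ k) b"
    then show ?thesis using sb[of k] sb[of "Suc k"] by simp
  next
    assume i: "i \<notin> Orbits.orbit x a" "i \<notin> Orbits.orbit x b"
    have "x i \<notin> Orbits.orbit x c" if "i \<notin> Orbits.orbit x c" for c
      using cyclic_on_f_in[OF assms(2) cyclic_on_orbit'[OF px]] that by blast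
    then show ?thesis using i sc by simp
  qed
  have "s permutes A"
  proof (rule bij_imp_permutes)
    have "s i \<in> A" if "i \<in> A" for i
    proof -
      have "(x ^^ k) c \<in> A" if "c \<in> A" for c k
        using permutes_in_image[OF permutes_funpow[OF assms(2)]] that by blast
      then show ?thesis using that assms(3,4) by (simp add: s_def)
    qed
    then show "bij_betw s A A"
      by (intro bij_betw_byWitness[where f' = s]) (auto simp: ss)
    fix i assume "i \<notin> A"
    then show "s i = i"
      using permutes_orbit_subset[OF assms(2,3)] permutes_orbit_subset[OF assms(2,4)]
      by (intro sc) blast+
  qed
  moreover have "s a = b" using sa[of 0] by simp
  ultimately show thesis using that ss sx by blast
qed

text \<open>The group is the lift of the powers of \<open>quot x\<close>. The transposition belongs
  to it because \<open>{a, b}\<close> is a pair of \<open>s\<close>, so it acts trivially on the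
  pairs.\<close>

lemma transpose_mem_two_perm_group:
  fixes A :: "'a::linorder set"
  assumes "finite A" "x permutes A" "x ^^ (2 ^ k) = id" "a \<in> A" "b \<in> A"
    and "Orbits.orbit x a \<noteq> Orbits.orbit x b" "card (Orbits.orbit x a) = card (Orbits.orbit x b)"
  obtains H where "two_perm_group A H" "x \<in> H" "transpose a b \<in> H"
proof -
  obtain s where s: "s permutes A" "\<And>i. s (s i) = i" "\<And>i. x (s i) = s (x i)" "s a = b"
    using ex_involution_swapping_orbits[OF assms(1,2,4-7)] by blast
  interpret involution A s using assms(1) s by unfold_locales
  have x: "x \<in> centralizer" using assms(2) s(3) by (simp add: centralizer_def)
  define M where "M = range (\<lambda>j. quot x ^^ j)"
  have "quot x ^^ (2 ^ k) = id" using quot_funpow[OF x, of "2 ^ k"] assms(3) quot_id by simp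
  then have M: "two_perm_group reps M"
    unfolding M_def by (rule two_perm_group_powers[OF quot_permutes[OF x]])
  have "quot x ^^ 1 \<in> M" unfolding M_def by (rule rangeI)
  then have "x \<in> lift M" using x by (simp add: lift_def)
  moreover have "transpose a b \<in> lift M"
  proof -
    have "s b = a" using s(2)[of a] s(4) by simp
    have t: "transpose a b i = i \<or> transpose a b i = s i" for i
      using s(4) \<open>s b = a\<close> by (simp add: transpose_def)
    have "transpose a b (s i) = s (transpose a b i)" for i
      using s_eq_iff[of i a] s_eq_iff[of i b] s(4) \<open>s b = a\<close> by (simp add: transpose_def)
    then have "transpose a b \<in> centralizer"
      using permutes_swap_id[OF assms(4,5)] by (simp add: centralizer_def)
    moreover have "quot (transpose a b) = id"
    proof
      fix i
      have "rep (transpose a b i) = rep i" using t[of i] rep_s[of i] by auto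
      then show "quot (transpose a b) i = id i" by (simp add: quot_def rep_id)
    qed
    ultimately show ?thesis using two_perm_groupD(2)[OF M] by (simp add: lift_def)
  qed
  ultimately show thesis using that two_perm_group_lift[OF M] by blast
qed

text \<open>The product of the two transpositions is a 3-cycle, whose orbit length would divide both
  3 and a power of 2.\<close>

lemma two_perm_group_no_three_cycle:
  assumes "finite A" "two_perm_group A H" "transpose a b \<in> H" "transpose b c \<in> H"
    and "a \<noteq> b" "b \<noteq> c" "a \<noteq> c"
  shows False
proof -
  define h where "h = transpose a b \<circ> transpose b c"
  have "h \<in> H" unfolding h_def by (rule two_perm_groupD(3)[OF assms(2-4)])
  then obtain k where k: "h ^^ (2 ^ k) = id" using two_perm_groupD(4)[OF assms(2)] by blast
  have "permutation h"
    using two_perm_groupD(1)[OF assms(2) \<open>h \<in> H\<close>] assms(1) permutation_permutes by blast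
  note fix_iff = funpow_fix_iff_card_orbit_dvd[OF this]
  have h: "h a = b" "h b = c" "h c = a" using assms(5-7) by (simp_all add: h_def transpose_def)
  have "card (Orbits.orbit h a) dvd 3"
    using fix_iff[of 3 a] h by (simp add: numeral_3_eq_3)
  moreover have "card (Orbits.orbit h a) dvd 2 ^ k" using fix_iff[of "2 ^ k" a] k by simp
  moreover have "coprime 3 (2 ^ k :: nat)" by simp
  ultimately have "card (Orbits.orbit h a) dvd 1" by (metis coprime_common_divisor)
  then have "h a = a" using fix_iff[of 1 a] by simp
  then show False using h assms(5) by simp
qed

section \<open>Sylow 2-subgroups of the symmetric group\<close>

text \<open>Bridge between Sylow theory in \<open>sym_group n\<close> and 2-groups on an arbitrary
  set. From left to right, raising an element to the order of \<open>P\<close> gives the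
  identity.\<close>

lemma sym_group_subgroup_iff_two_perm_group:
  "(subgroup P (sym_group n) \<and> (\<exists>k. card P = 2 ^ k)) \<longleftrightarrow> two_perm_group {1..n} P"
proof
  assume P: "subgroup P (sym_group n) \<and> (\<exists>k. card P = 2 ^ k)"
  then obtain k where k: "card P = 2 ^ k" by blast
  interpret P: subgroup P "sym_group n" using P by blast
  interpret K: group "sym_group n\<lparr>carrier := P\<rparr>"
    using P group.subgroup_imp_group[OF sym_group_is_group] by blast
  have "h ^^ (2 ^ k) = id" if "h \<in> P" for h
  proof -
    have "h [^]\<^bsub>sym_group n\<lparr>carrier := P\<rparr>\<^esub> order (sym_group n\<lparr>carrier := P\<rparr>) = id"
      using K.pow_order_eq_1[of h] that by (simp add: sym_group_one)
    then show ?thesis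
      using nat_pow_eq_funpow[of "sym_group n\<lparr>carrier := P\<rparr>" h "2 ^ k"] k
      by (simp add: order_def sym_group_mult sym_group_one)
  qed
  then show "two_perm_group {1..n} P"
    using P.subset P.m_closed P.one_closed unfolding two_perm_group_def
    by (simp add: sym_group_def) blast
next
  assume P: "two_perm_group {1..n} P"
  interpret G: group "sym_group n" by (rule sym_group_is_group)
  have "subgroup P (sym_group n)"
  proof (rule G.subgroupI)
    show sub: "P \<subseteq> carrier (sym_group n)"
      using two_perm_groupD(1)[OF P] by (auto simp: sym_group_carrier)
    show "P \<noteq> {}" using two_perm_groupD(2)[OF P] by blast
    show "g \<otimes>\<^bsub>sym_group n\<^esub> h \<in> P" if "g \<in> P" "h \<in> P" for g h
      using two_perm_groupD(3)[OF P that] by (simp add: sym_group_mult)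
    fix h assume h: "h \<in> P"
    then have "inv' h \<in> P" by (rule two_perm_group_inv[OF P])
    moreover have "inv' h \<otimes>\<^bsub>sym_group n\<^esub> h = \<one>\<^bsub>sym_group n\<^esub>"
      using permutes_inv_o(2)[OF two_perm_groupD(1)[OF P h]] by (simp add: sym_group_mult sym_group_one)
    ultimately show "inv\<^bsub>sym_group n\<^esub> h \<in> P"
      using G.inv_equality[of "inv' h" h] h sub by auto
  qed
  then show "subgroup P (sym_group n) \<and> (\<exists>k. card P = 2 ^ k)"
    using card_two_perm_group[OF P] by simp
qed

lemma finite_carrier_sym_group: "finite (carrier (sym_group n))"
  using finite_permutations[of "{1..n}"] by (simp add: sym_group_def)

lemma two_perm_group_in_sylow_subgroup:
  assumes "two_perm_group {1..n} H"
  obtains Q where "sylow_subgroup (sym_group n) 2 Q" "H \<subseteq> Q"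
proof -
  obtain k where "subgroup H (sym_group n)" "card H = 2 ^ k"
    using assms sym_group_subgroup_iff_two_perm_group by blast
  then show thesis
    using group.p_subgroup_in_sylow_subgroup[OF sym_group_is_group finite_carrier_sym_group two_is_prime_nat]
      that by blast
qed

lemma sylow_subgroup_two_perm_group:
  "sylow_subgroup (sym_group n) 2 P \<Longrightarrow> two_perm_group {1..n} P"
  using sym_group_subgroup_iff_two_perm_group[of P n] unfolding sylow_subgroup_def by blast

theorem theoremC:
  fixes n :: nat and x :: "nat \<Rightarrow> nat"
  assumes "n \<ge> 2"
    and "p_element (sym_group n) 2 x"
  shows "(\<exists>!P. sylow_subgroup (sym_group n) 2 P \<and> x \<in> P) \<longleftrightarrow>
         card (fixed_points n x) \<le> 2 \<and> nontrivial_cycle_lengths_distinct n x"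
proof -
  interpret G: group "sym_group n" by (rule sym_group_is_group)
  have x: "x permutes {1..n}" using assms(2) by (simp add: p_element_def sym_group_carrier)
  obtain k where "G.ord x = 2 ^ k" using assms(2) unfolding p_element_def by blast
  then have "x [^]\<^bsub>sym_group n\<^esub> ((2::nat) ^ k) = \<one>\<^bsub>sym_group n\<^esub>"
    using assms(2) G.pow_ord_eq_1[of x] by (simp add: p_element_def)
  then have xk: "x ^^ (2 ^ k) = id"
    by (simp add: nat_pow_eq_funpow sym_group_mult sym_group_one)
  have distinct: "card (fixed_points n x) \<le> 2 \<and> nontrivial_cycle_lengths_distinct n x
      \<longleftrightarrow> distinct_cycles {1..n} x"
    unfolding distinct_cycles_def fixed_points_def nontrivial_cycle_lengths_distinct_def ..
  have "distinct_cycles {1..n} x" if uniq: "\<exists>!P. sylow_subgroup (sym_group n) 2 P \<and> x \<in> P"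
  proof -
    obtain P where P: "sylow_subgroup (sym_group n) 2 P" "x \<in> P"
      "\<And>Q. sylow_subgroup (sym_group n) 2 Q \<Longrightarrow> x \<in> Q \<Longrightarrow> Q = P" using uniq by blast
    have transp: "transpose a b \<in> P"
      \<comment> \<open>A 2-group containing \<open>x\<close> and the transposition extends to a
        Sylow subgroup, which contains \<open>x\<close> and hence equals \<open>P\<close>.\<close>
      if ab: "a \<in> {1..n}" "b \<in> {1..n}" "Orbits.orbit x a \<noteq> Orbits.orbit x b"
        "card (Orbits.orbit x a) = card (Orbits.orbit x b)" for a b
    proof -
      obtain H where H: "two_perm_group {1..n} H" "x \<in> H" "transpose a b \<in> H"
        using transpose_mem_two_perm_group[OF _ x xk ab] by blast
      obtain Q where "sylow_subgroup (sym_group n) 2 Q" "H \<subseteq> Q"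
        using two_perm_group_in_sylow_subgroup[OF H(1)] by blast
      then show ?thesis using P(3) H by blast
    qed
    note no3 = two_perm_group_no_three_cycle[OF _ sylow_subgroup_two_perm_group[OF P(1)]]
    have "card {i \<in> {1..n}. x i = i} \<le> 2"
    \<comment> \<open>Three fixed points are three distinct orbits of length one, so two overlapping
      transpositions lie in \<open>P\<close>.\<close>
    proof (rule ccontr)
      assume "\<not> ?thesis"
      then have "3 \<le> card {i \<in> {1..n}. x i = i}" by simp
      then obtain T where T: "T \<subseteq> {i \<in> {1..n}. x i = i}" "card T = 3"
        by (rule obtain_subset_with_card_n)
      then obtain a b c where abc: "T = {a, b, c}" "a \<noteq> b" "b \<noteq> c" "a \<noteq> c"
        using card_3_iff[of T] by blast
      then have fix_pts: "a \<in> {1..n}" "b \<in> {1..n}" "c \<in> {1..n}" "x a = a" "x b = b" "x c = c"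
        using T(1) by auto
      then have "Orbits.orbit x a = {a}" "Orbits.orbit x b = {b}" "Orbits.orbit x c = {c}"
        by (simp_all add: orbit_eq_singleton_iff)
      then have "transpose a b \<in> P" "transpose b c \<in> P"
        using transp[of a b] transp[of b c] fix_pts abc by simp_all
      then show False using no3[of a b c] abc by simp
    qed
    moreover have "Orbits.orbit x i = Orbits.orbit x j"
      if ij: "i \<in> {1..n}" "j \<in> {1..n}" "x j \<noteq> j"
        "card (Orbits.orbit x i) = card (Orbits.orbit x j)" for i j
    proof (rule ccontr)
      assume ne: "Orbits.orbit x i \<noteq> Orbits.orbit x j"
      have px: "permutation x" using x permutation_permutes[of x] by blast
      \<comment> \<open>The points \<open>j\<close> and \<open>x j\<close> are different but share
        an orbit, so \<open>i\<close> can be exchanged with either of them.\<close>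
      have step: "Orbits.orbit x (x j) = Orbits.orbit x j" by (rule permutation_orbit_step[OF px])
      have xj: "x j \<in> {1..n}" using permutes_in_image[OF x] ij(2) by blast
      have "transpose i j \<in> P" by (rule transp[OF ij(1,2) ne ij(4)])
      moreover have "transpose i (x j) \<in> P"
        using transp[OF ij(1) xj] ne ij(4) step by simp
      moreover have "i \<noteq> j" "i \<noteq> x j" using ne step by auto
      ultimately show False using no3[of j i "x j"] ij(3) by (simp add: transpose_commute)
    qed
    ultimately show ?thesis unfolding distinct_cycles_def by blast
  qed
  moreover have "\<exists>!P. sylow_subgroup (sym_group n) 2 P \<and> x \<in> P" if dist: "distinct_cycles {1..n} x"
  proof -
    obtain M where M: "two_perm_group {1..n} M"
      "\<And>Q. two_perm_group {1..n} Q \<Longrightarrow> x \<in> Q \<Longrightarrow> Q \<subseteq> M"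
      using ex_greatest_two_perm_group[OF _ x dist] by blast
    obtain R where R: "sylow_subgroup (sym_group n) 2 R" "M \<subseteq> R"
      using two_perm_group_in_sylow_subgroup[OF M(1)] by blast
    \<comment> \<open>Every Sylow subgroup containing \<open>x\<close> lies in \<open>M\<close> and
      hence in \<open>R\<close>; equal cardinality forces equality.\<close>
    have eq: "Q = R" if Q: "sylow_subgroup (sym_group n) 2 Q" "x \<in> Q" for Q
    proof (rule card_subset_eq)
      show "finite R"
        using R(1) finite_carrier_sym_group[of n] subgroup.subset[of R "sym_group n"] finite_subset
        unfolding sylow_subgroup_def by blast
      show "Q \<subseteq> R" using M(2)[OF sylow_subgroup_two_perm_group[OF Q(1)] Q(2)] R(2) by blast
      show "card Q = card R" using Q(1) R(1) by (simp add: sylow_subgroup_def)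
    qed
    \<comment> \<open>Existence: the cyclic 2-group generated by \<open>x\<close> lies in some Sylow
      subgroup.\<close>
    obtain Q where Q: "sylow_subgroup (sym_group n) 2 Q" "range (\<lambda>j. x ^^ j) \<subseteq> Q"
      using two_perm_group_in_sylow_subgroup[OF two_perm_group_powers[OF x xk]] by blast
    have "x ^^ 1 \<in> Q" using Q(2) by blast
    then have "x \<in> Q" by simp
    then show ?thesis using eq Q(1) by blast
  qed
  ultimately show ?thesis using distinct by blast
qed

end
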